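(* Let $q\ge0$ be an integer, let $p,p'$ be complex numbers such that none of $p,\ p',\ p+p'-1$ is zero or a negative integer, and let $y$ be a complex number. Then $$\sum_{m=0}^q\frac{(-1)^m}{(p,m)(p',q-m)}L_m^{(p-1)}(-y)\,L_{q-m}^{(p'-1)}(y)=\frac{\left(\frac{p+p'-1}{2},q\right)\left(\frac{p+p'}{2},q\right)(-4y)^q}{(p,q)(p',q)(p+p'-1,q)\,q!}.$$
   Context: $(\alpha,n)=\alpha(\alpha+1)\cdots(\alpha+n-1)$ for $n\ge1$ and $(\alpha,0)=1$ (Pochhammer symbol). The Laguerre polynomial is $L_n^{(a)}(x)=\frac{(a+1,n)}{n!}\,{}_1F_1[-n;a+1;x]=\frac{1}{n!}\sum_{k=0}^n\frac{(-n,k)\,(a+1,n)}{(a+1,k)\,k!}x^k$. *)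

theory Defs
  imports Complex_Main "HOL-Library.Nonpos_Ints"
begin

(* The parameter a is meant to satisfy a + 1 \<notin> \<int>\<^sub>\<le>\<^sub>0: otherwise some
   pochhammer (a + 1) k is 0, and those terms are 0 because x / 0 = 0. *)
definition laguerre :: "nat \<Rightarrow> complex \<Rightarrow> complex \<Rightarrow> complex" where
  "laguerre n a x =
     1 / fact n *
     (\<Sum>k=0..n. pochhammer (- of_nat n) k * pochhammer (a + 1) n
                  / (pochhammer (a + 1) k * fact k) * x ^ k)"

end

(* Since L_m^(p-1)(x) / (p,m) is the sum of (-x)^k / ((m-k)! k! (p,k)), the generating functions of
   the two Laguerre factors are exp(-t) and exp(t) times 0F1(;p;-yt) and 0F1(;p';-yt).  The
   exponentials cancel, so the sum is the coefficient of t^q in 0F1(;p;-yt) 0F1(;p';-yt), which is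
   evaluated by the Chu-Vandermonde identity and the duplication formula for (p+p'-1,2q). *)
theory Submission
  imports Defs "HOL-Computational_Algebra.Formal_Power_Series"
begin

lemma pochhammer_nonzero:
  fixes a :: "'a::field_char_0"
  assumes "a \<notin> \<int>\<^sub>\<le>\<^sub>0"
  shows "pochhammer a n \<noteq> 0"
  using assms by (auto simp: pochhammer_eq_0_iff)

text \<open>Compare the factorial form of the binomial coefficient with its generalized form, which
  is a Pochhammer symbol at \<open>- n\<close>.\<close>

lemma pochhammer_neg_of_nat:
  assumes "k \<le> n"
  shows "pochhammer (- of_nat n :: 'a::field_char_0) k = (-1) ^ k * fact n / fact (n - k)"
proof -
  have "fact n / (fact k * fact (n - k)) = (-1) ^ k / fact k * pochhammer (- of_nat n :: 'a) k"
    using binomial_fact[OF assms, where ?'a = 'a] binomial_gbinomial[of n k, where ?'a = 'a]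
      gbinomial_pochhammer[of "of_nat n :: 'a" k] by simp
  hence "(-1) ^ k * fact n / fact (n - k) = ((-1) ^ k * (-1) ^ k) * pochhammer (- of_nat n :: 'a) k"
    by (simp add: field_simps)
  thus ?thesis
    by (simp flip: power_mult_distrib)
qed

text \<open>The division cancels the factor \<open>pochhammer (a + 1) n\<close> of the Laguerre
  polynomial. What remains is a convolution with the coefficients of the exponential series.\<close>

lemma laguerre_over_pochhammer:
  assumes "p \<notin> \<int>\<^sub>\<le>\<^sub>0"
  shows "laguerre m (p - 1) x / pochhammer p m =
    (\<Sum>k=0..m. (- x) ^ k / (fact k * pochhammer p k) / fact (m - k))"
proof -
  have "laguerre m (p - 1) x / pochhammer p m =
      (\<Sum>k=0..m. pochhammer (- of_nat m) k * x ^ k / (fact m * (pochhammer p k * fact k)))"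
    using pochhammer_nonzero[OF assms]
    by (simp add: laguerre_def sum_distrib_left sum_divide_distrib mult_ac)
  also have "\<dots> = (\<Sum>k=0..m. (- x) ^ k / (fact k * pochhammer p k) / fact (m - k))"
  proof (rule sum.cong)
    fix k assume "k \<in> {0..m}"
    hence "k \<le> m" by simp
    thus "pochhammer (- of_nat m) k * x ^ k / (fact m * (pochhammer p k * fact k)) =
        (- x) ^ k / (fact k * pochhammer p k) / fact (m - k)"
      by (simp add: pochhammer_neg_of_nat power_minus[of x] field_simps)
  qed simp
  finally show ?thesis .
qed

text \<open>The series 0F1(;p;ct) in the formal variable t. The scale \<open>c\<close> is built into
  the coefficients, so that no composition of series is needed.\<close>

definition hyp_0F1_fps :: "complex \<Rightarrow> complex \<Rightarrow> complex fps" where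
  "hyp_0F1_fps p c = Abs_fps (\<lambda>k. c ^ k / (fact k * pochhammer p k))"

text \<open>The Cauchy product is the convolution above, with \<open>c ^ k\<close> and
  \<open>c ^ (m - k)\<close> merging into \<open>c ^ m\<close>. The free scale \<open>c\<close>
  serves to produce the alternating sign of the theorem.\<close>

lemma laguerre_generating_function:
  assumes "p \<notin> \<int>\<^sub>\<le>\<^sub>0"
  shows "fps_nth (hyp_0F1_fps p (- x * c) * fps_exp c) m = c ^ m * (laguerre m (p - 1) x / pochhammer p m)"
proof -
  have "fps_nth (hyp_0F1_fps p (- x * c) * fps_exp c) m =
      (\<Sum>k=0..m. (- x) ^ k * (c ^ k * c ^ (m - k)) / (fact k * pochhammer p k) / fact (m - k))"
    unfolding fps_mult_nth hyp_0F1_fps_def power_mult_distrib by (simp add: mult_ac)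
  also have "\<dots> = (\<Sum>k=0..m. c ^ m * ((- x) ^ k / (fact k * pochhammer p k) / fact (m - k)))"
    by (rule sum.cong) (simp_all flip: power_add)
  finally show ?thesis
    by (simp add: laguerre_over_pochhammer[OF assms] sum_distrib_left)
qed

text \<open>Over the common denominator, the numerators are the complementary products
  (p+k)...(p+q-1) and (p'+q-k)...(p'+q-1). Read backwards and negated, they are Pochhammer symbols
  with bases independent of k, so Chu-Vandermonde applies.\<close>

lemma sum_inverse_pochhammer_fact:
  fixes p p' :: "'a::field_char_0"
  assumes "p \<notin> \<int>\<^sub>\<le>\<^sub>0" and "p' \<notin> \<int>\<^sub>\<le>\<^sub>0"
  shows "(\<Sum>k=0..q. 1 / (fact k * pochhammer p k * (fact (q - k) * pochhammer p' (q - k)))) =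
    pochhammer (p + p' - 1 + of_nat q) q / (fact q * pochhammer p q * pochhammer p' q)"
proof -
  note nz = pochhammer_nonzero[OF assms(1)] pochhammer_nonzero[OF assms(2)]
  \<comment> \<open>For q > 0 these are the last factors of \<open>pochhammer p q\<close> and
    \<open>pochhammer p' q\<close>, where the reversed products start.\<close>
  define a b where "a = p + of_nat q - 1" and "b = p' + of_nat q - 1"
  have "1 / (fact k * pochhammer p k * (fact (q - k) * pochhammer p' (q - k))) =
      (-1) ^ q * (of_nat (q choose k) * pochhammer (- b) k * pochhammer (- a) (q - k)) /
        (fact q * pochhammer p q * pochhammer p' q)" if "k \<le> q" for k
  proof -
    have P: "pochhammer p q = pochhammer p k * pochhammer (p + of_nat k) (q - k)"
      by (rule pochhammer_product[OF that])
    have P': "pochhammer p' q = pochhammer p' (q - k) * pochhammer (p' + of_nat (q - k)) k"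
      using pochhammer_product[of "q - k" q p'] that by simp
    have A: "pochhammer (- a) (q - k) = (-1) ^ (q - k) * pochhammer (p + of_nat k) (q - k)"
      using that by (simp only: pochhammer_minus) (simp add: a_def of_nat_diff)
    have B: "pochhammer (- b) k = (-1) ^ k * pochhammer (p' + of_nat (q - k)) k"
      using that by (simp only: pochhammer_minus) (simp add: b_def of_nat_diff algebra_simps)
    have S: "(-1) ^ q * ((-1) ^ k * (-1) ^ (q - k)) = (1::'a)"
      using that by (simp flip: power_add power_mult_distrib)
    have "(-1) ^ q * (of_nat (q choose k) * pochhammer (- b) k * pochhammer (- a) (q - k)) =
        ((-1) ^ q * ((-1) ^ k * (-1) ^ (q - k))) * (fact q / (fact k * fact (q - k)) *
          (pochhammer (p' + of_nat (q - k)) k * pochhammer (p + of_nat k) (q - k)))"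
      using that by (simp add: A B binomial_fact mult_ac)
    also have "\<dots> = fact q / (fact k * fact (q - k)) *
          (pochhammer p' q / pochhammer p' (q - k) * (pochhammer p q / pochhammer p k))"
      unfolding S using nz by (simp add: P[symmetric] P')  (simp add: P)
    finally show ?thesis
      using nz by (simp add: field_simps)
  qed
  \<comment> \<open>\<open>pochhammer_binomial_sum\<close> is Chu-Vandermonde in binomial
    form.\<close>
  hence "(\<Sum>k=0..q. 1 / (fact k * pochhammer p k * (fact (q - k) * pochhammer p' (q - k)))) =
      (-1) ^ q * pochhammer (- b + - a) q / (fact q * pochhammer p q * pochhammer p' q)"
    unfolding pochhammer_binomial_sum sum_distrib_left sum_divide_distrib atMost_atLeast0
    by (intro sum.cong) simp_all
  \<comment> \<open>Reversing the product back makes it start at a + b - q + 1 = p + p' - 1 +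
    q.\<close>
  also have "(-1) ^ q * pochhammer (- b + - a) q = pochhammer (p + p' - 1 + of_nat q) q"
    using pochhammer_minus[of "a + b" q]
    by (simp add: a_def b_def algebra_simps flip: power_mult_distrib)
  finally show ?thesis .
qed

text \<open>Evaluate \<open>pochhammer s (2 * q)\<close> twice: by cutting it after q factors, and
  by separating factors at even and odd positions.\<close>

lemma pochhammer_shift_duplication:
  fixes s :: "'a::field_char_0"
  assumes "s \<notin> \<int>\<^sub>\<le>\<^sub>0"
  shows "pochhammer (s + of_nat q) q =
    4 ^ q * pochhammer (s / 2) q * pochhammer ((s + 1) / 2) q / pochhammer s q"
proof -
  have "pochhammer s (2 * q) = 4 ^ q * pochhammer (s / 2) q * pochhammer ((s + 1) / 2) q"
    using pochhammer_double[of "s / 2" q] by (simp add: power_mult add_divide_distrib)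
  moreover have "pochhammer s (2 * q) = pochhammer s q * pochhammer (s + of_nat q) q"
    using pochhammer_product'[of s q q] by (simp add: mult_2)
  ultimately show ?thesis
    using pochhammer_nonzero[OF assms] by (simp add: field_simps)
qed

theorem mainTheorem13:
  fixes q :: nat and p p' y :: complex
  assumes "p \<notin> \<int>\<^sub>\<le>\<^sub>0" and "p' \<notin> \<int>\<^sub>\<le>\<^sub>0" and "p + p' - 1 \<notin> \<int>\<^sub>\<le>\<^sub>0"
  shows "(\<Sum>m=0..q. (-1) ^ m / (pochhammer p m * pochhammer p' (q - m))
             * laguerre m (p - 1) (- y) * laguerre (q - m) (p' - 1) y)
         = pochhammer ((p + p' - 1) / 2) q * pochhammer ((p + p') / 2) q * (- 4 * y) ^ q
           / (pochhammer p q * pochhammer p' q * pochhammer (p + p' - 1) q * fact q)"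
proof -
  define F G where "F = hyp_0F1_fps p (- y)" and "G = hyp_0F1_fps p' (- y)"
  \<comment> \<open>The generating function is used with \<open>x = - y\<close>,
    \<open>c = -1\<close> and with \<open>x = y\<close>, \<open>c = 1\<close>. Both give
    \<open>- x * c = - y\<close>, and the first supplies the sign \<open>(-1) ^ m\<close>.\<close>
  have "(\<Sum>m=0..q. (-1) ^ m / (pochhammer p m * pochhammer p' (q - m))
             * laguerre m (p - 1) (- y) * laguerre (q - m) (p' - 1) y) =
      fps_nth ((F * fps_exp (-1)) * (G * fps_exp 1)) q"
    unfolding fps_mult_nth[of "F * fps_exp (-1)" "G * fps_exp 1"]
    using laguerre_generating_function[OF assms(1), of "- y" "-1"]
      laguerre_generating_function[OF assms(2), of y 1]
    by (simp add: F_def G_def)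
  also have "(F * fps_exp (-1)) * (G * fps_exp 1) = F * G * fps_exp (-1 + 1)"
    by (simp only: fps_exp_add_mult mult_ac)
  also have "\<dots> = F * G"
    by simp
  also have "fps_nth (F * G) q = (\<Sum>k=0..q. (- y) ^ q *
      (1 / (fact k * pochhammer p k * (fact (q - k) * pochhammer p' (q - k)))))"
    unfolding fps_mult_nth
    by (rule sum.cong) (simp_all add: F_def G_def hyp_0F1_fps_def flip: power_add)
  also have "\<dots> = (- y) ^ q * (pochhammer (p + p' - 1 + of_nat q) q /
      (fact q * pochhammer p q * pochhammer p' q))"
    by (simp only: sum_inverse_pochhammer_fact[OF assms(1,2)] flip: sum_distrib_left)
  \<comment> \<open>Duplication with \<open>s = p + p' - 1\<close>, so that
    \<open>(s + 1) / 2\<close> is \<open>(p + p') / 2\<close>.\<close>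
  also have "\<dots> = pochhammer ((p + p' - 1) / 2) q * pochhammer ((p + p') / 2) q * (4 ^ q * (- y) ^ q)
           / (pochhammer p q * pochhammer p' q * pochhammer (p + p' - 1) q * fact q)"
    by (simp add: pochhammer_shift_duplication[OF assms(3)] mult_ac)
  also have "4 ^ q * (- y) ^ q = (- 4 * y) ^ q"
    by (simp flip: power_mult_distrib)
  finally show ?thesis .
qed

end
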